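(* There exists $\rho>0$ such that for $\mathbb{P}$-almost every $\omega\in W^{\mathbb{N}}$ there exists $C>0$ such that $$|\widehat{\mu}_\omega(\xi)|\le C|\xi|^{-\rho}\quad\text{for all }\xi\in\mathbb{R}\setminus\{0\}.$$
   Context: Let $W=[\lambda_{\min},\lambda_{\max}]\subset(0,1)$ be a closed interval with $\lambda_{\min}<\lambda_{\max}$. Let $\mathbb{P}$ be the product probability measure on $W^{\mathbb{N}}$ ($\mathbb{N}=\{1,2,\dots\}$) each of whose factors is the normalised Lebesgue (uniform) measure on $W$; thus the entries of $\omega=(\lambda_k)_{k\ge1}\in W^{\mathbb{N}}$ are i.i.d. uniform on $W$. For $\omega=(\lambda_k)\in W^{\mathbb{N}}$, the random Bernoulli convolution $\mu_\omega$ is the infinite convolution of the measures $\frac12(\delta_0+\delta_{\lambda_1\lambda_2\cdots\lambda_k})$, $k\ge1$; equivalently, $\mu_\omega$ is the push-forward of the $(\frac12,\frac12)$-Bernoulli measure on $\{0,1\}^{\mathbb{N}}$ under the map $(a_j)\mapsto\sum_{j=1}^\infty a_j\prod_{k=1}^j\lambda_k$. The Fourier transform of a Borel probability measure $\mu$ on $\mathbb{R}$ is $\widehat\mu(\xi)=\int e^{-2\pi i\xi x}\,d\mu(x)$. *)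

theory Defs
  imports "HOL-Probability.Probability"
begin

text \<open>
  Sequences are indexed by \<open>{1..}\<close>, as extensional functions on \<open>nat\<close>. The underlying space of each
  factor \<open>uniform_measure lborel {a..b}\<close> is all of \<open>\<real>\<close>, with the mass concentrated on \<open>{a..b}\<close>.
\<close>

definition iid_uniform :: "real \<Rightarrow> real \<Rightarrow> (nat \<Rightarrow> real) measure" where
  "iid_uniform a b = PiM {1..} (\<lambda>_. uniform_measure lborel {a..b})"

definition fair_digits :: "(nat \<Rightarrow> real) measure" where
  "fair_digits = PiM {1..} (\<lambda>_. uniform_count_measure {0, 1})"

text \<open>The sum runs over all \<open>j \<in> nat\<close>; its term with index \<open>j\<close> is the one belonging to digit \<open>Suc j\<close>.\<close>

definition digit_sum :: "(nat \<Rightarrow> real) \<Rightarrow> (nat \<Rightarrow> real) \<Rightarrow> real" where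
  "digit_sum \<omega> d = (\<Sum>j. d (Suc j) * (\<Prod>k=1..Suc j. \<omega> k))"

definition bernoulli_convolution :: "(nat \<Rightarrow> real) \<Rightarrow> real measure" where
  "bernoulli_convolution \<omega> = distr fair_digits borel (digit_sum \<omega>)"

definition fourier_transform :: "real measure \<Rightarrow> real \<Rightarrow> complex" where
  "fourier_transform M \<xi> = (CLINT x|M. iexp (- 2 * pi * \<xi> * x))"

lemma prob_space_iid_uniform:
  assumes "a < b"
  shows "prob_space (iid_uniform a b)"
  unfolding iid_uniform_def
  by (intro prob_space_PiM prob_space_uniform_measure) (use assms in auto)

lemma prob_space_fair_digits: "prob_space fair_digits"
  unfolding fair_digits_def
  by (intro prob_space_PiM prob_space_uniform_count_measure) auto

lemma measurable_digit_sum: "digit_sum \<omega> \<in> borel_measurable fair_digits"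
proof -
  have "(\<lambda>d. d (Suc j)) \<in> borel_measurable fair_digits" for j
  proof -
    have "(\<lambda>d. d (Suc j)) \<in> measurable fair_digits (uniform_count_measure {0, 1 :: real})"
      unfolding fair_digits_def by (rule measurable_component_singleton) simp
    moreover have "(\<lambda>x. x) \<in> borel_measurable (uniform_count_measure {0, 1 :: real})"
      by (auto simp: measurable_def space_uniform_count_measure sets_uniform_count_measure)
    ultimately show ?thesis
      by (rule measurable_compose)
  qed
  then show ?thesis
    unfolding digit_sum_def by (intro borel_measurable_suminf borel_measurable_times) auto
qed

lemma prob_space_bernoulli_convolution: "prob_space (bernoulli_convolution \<omega>)"
  unfolding bernoulli_convolution_def
  by (intro prob_space.prob_space_distr prob_space_fair_digits measurable_digit_sum)

end

theory Submission
  imports Defs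
begin

text \<open>
  Up to a unimodular factor, the Fourier transform of \<open>\<mu>\<^sub>\<omega>\<close> at \<open>\<xi>\<close> is the product of the numbers
  \<open>cos (\<pi> \<xi> \<lambda>\<^sub>1 \<cdots> \<lambda>\<^sub>k)\<close>, so that every finite product of their absolute values is an upper bound
  (\<open>cmod_fourier_transform_le_cosine_product\<close>).

  The idea is to bound a high moment of such a product. As long as \<open>t = \<xi> \<lambda>\<^sub>1 \<cdots> \<lambda>\<^sub>k\<^sub>-\<^sub>1\<close> is large,
  the next argument \<open>\<pi> t \<lambda>\<^sub>k\<close> is spread over at least about one period of the cosine, even when the
  past is fixed. Hence the conditional mean of \<open>\<bar>cos (\<pi> t \<lambda>\<^sub>k)\<bar>\<^sup>p\<close> is at most a constant times the mean
  of \<open>\<bar>cos\<bar>\<^sup>p\<close> over a period, and that is as small as desired once \<open>p\<close> is large, by dominated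
  convergence (\<open>cos_power_mean_small\<close>). The threshold for \<open>t\<close> does not depend on \<open>p\<close>. Choose \<open>p\<close> such
  that each factor contributes at most \<open>\<lambda>\<^sub>m\<^sub>i\<^sub>n\<^sup>6\<close>. Since \<open>t \<ge> \<xi> \<lambda>\<^sub>m\<^sub>i\<^sub>n\<^sup>k\<^sup>-\<^sup>1\<close>, there are at least about
  \<open>log \<xi> / log (1 / \<lambda>\<^sub>m\<^sub>i\<^sub>n)\<close> such factors, and the \<open>p\<close>-th moment is \<open>O(\<xi>\<^sup>-\<^sup>6)\<close>
  (\<open>nn_integral_PiM_prod_partial_products_le\<close>).

  A bound for each fixed \<open>\<xi>\<close> becomes an almost sure bound for all \<open>\<xi>\<close> by means of the grid
  \<open>\<xi> = \<surd>m\<close>. The \<open>p\<close>-th moment at \<open>\<surd>m\<close> is \<open>O(m\<^sup>-\<^sup>3)\<close>, so \<open>m\<close> times it is summable, and almost surely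
  the product at \<open>\<surd>m\<close> is \<open>O(m\<^sup>-\<^sup>1\<^sup>/\<^sup>p)\<close>, that is, \<open>O(\<xi>\<^sup>-\<^sup>2\<^sup>/\<^sup>p)\<close>
  (\<open>AE_bounded_of_summable_expectations\<close>). Near \<open>\<xi>\<close> the grid has spacing \<open>O(1 / \<xi>)\<close>, and the products are
  Lipschitz in \<open>\<xi>\<close> uniformly in their length, so the bound passes to all \<open>\<xi>\<close>
  (\<open>decay_of_sqrt_grid_bound\<close>). The exponent obtained is \<open>\<rho> = 2 / p\<close>.
\<close>

section \<open>Products of cosines\<close>

definition cosine_product :: "(nat \<Rightarrow> real) \<Rightarrow> nat \<Rightarrow> real \<Rightarrow> real" where
  "cosine_product \<omega> n \<xi> = (\<Prod>k=1..n. \<bar>cos (pi * \<xi> * (\<Prod>i=1..k. \<omega> i))\<bar>)"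

lemma cosine_product_nonneg: "0 \<le> cosine_product \<omega> n \<xi>"
  unfolding cosine_product_def by (intro prod_nonneg) auto

lemma measurable_cosine_product [measurable]:
  "(\<lambda>\<omega>. cosine_product \<omega> n \<xi>) \<in> borel_measurable (iid_uniform a b)"
proof -
  have [measurable_cong]: "sets (uniform_measure lborel {a..b}) = sets borel" by simp
  show ?thesis
    unfolding cosine_product_def iid_uniform_def by measurable
qed

lemma cosine_product_minus: "cosine_product \<omega> n (- \<xi>) = cosine_product \<omega> n \<xi>"
  by (simp add: cosine_product_def)

lemma cosine_product_antimono:
  assumes "m \<le> n"
  shows "cosine_product \<omega> n \<xi> \<le> cosine_product \<omega> m \<xi>"
  using assms
proof (induction rule: dec_induct)
  case (step n)
  have "cosine_product \<omega> (Suc n) \<xi> \<le> cosine_product \<omega> n \<xi> * 1"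
    unfolding cosine_product_def by (auto simp: prod.nat_ivl_Suc' intro!: mult_left_le prod_nonneg)
  with step.IH show ?case by simp
qed simp

lemma prod_le_power_of_bound:
  fixes \<omega> :: "nat \<Rightarrow> real"
  assumes "\<And>k. 1 \<le> k \<Longrightarrow> 0 \<le> \<omega> k \<and> \<omega> k \<le> b"
  shows "0 \<le> (\<Prod>i=1..k. \<omega> i)" "(\<Prod>i=1..k. \<omega> i) \<le> b ^ k"
proof -
  show "0 \<le> (\<Prod>i=1..k. \<omega> i)"
    using assms by (intro prod_nonneg) auto
  have "(\<Prod>i=1..k. \<omega> i) \<le> (\<Prod>i=1..k. b)"
    using assms by (intro prod_mono) auto
  then show "(\<Prod>i=1..k. \<omega> i) \<le> b ^ k" by simp
qed

lemma abs_cos_diff_le: "\<bar>\<bar>cos x\<bar> - \<bar>cos y\<bar>\<bar> \<le> \<bar>x - y :: real\<bar>"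
proof -
  have "norm (cos x - cos y) \<le> 1 * norm (x - y)"
  proof (rule field_differentiable_bound[where S = UNIV and f' = "\<lambda>x. - sin x"])
    show "norm (- sin z) \<le> 1" for z :: real
      by (simp add: abs_sin_le_one)
  qed (auto intro!: derivative_eq_intros)
  then show ?thesis
    using abs_triangle_ineq3[of "cos x" "cos y"] by simp
qed

text \<open>
  The \<open>k\<close>-th factor has Lipschitz constant \<open>\<pi> b\<^sup>k\<close>, and the others are bounded by 1. The geometric
  series makes the constant independent of \<open>n\<close>, so \<open>n\<close> can later be chosen depending on \<open>\<xi>\<close>.
\<close>

lemma cosine_product_lipschitz:
  assumes "\<And>k. 1 \<le> k \<Longrightarrow> 0 \<le> \<omega> k \<and> \<omega> k \<le> b" and "0 < b" "b < 1"
  shows "\<bar>cosine_product \<omega> n x - cosine_product \<omega> n y\<bar> \<le> pi / (1 - b) * \<bar>x - y\<bar>"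
proof -
  note r = prod_le_power_of_bound[where \<omega> = \<omega>, OF assms(1)]
  have "\<bar>cosine_product \<omega> n x - cosine_product \<omega> n y\<bar>
      \<le> (\<Sum>k=1..n. \<bar>\<bar>cos (pi * x * (\<Prod>i=1..k. \<omega> i))\<bar> - \<bar>cos (pi * y * (\<Prod>i=1..k. \<omega> i))\<bar>\<bar>)"
    unfolding cosine_product_def real_norm_def[symmetric]
    by (rule norm_prod_diff) auto
  also have "\<dots> \<le> (\<Sum>k=1..n. pi * \<bar>x - y\<bar> * b ^ k)"
  proof (rule sum_mono)
    fix k
    have "\<bar>\<bar>cos (pi * x * (\<Prod>i=1..k. \<omega> i))\<bar> - \<bar>cos (pi * y * (\<Prod>i=1..k. \<omega> i))\<bar>\<bar>
        \<le> \<bar>pi * x * (\<Prod>i=1..k. \<omega> i) - pi * y * (\<Prod>i=1..k. \<omega> i)\<bar>"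
      by (rule abs_cos_diff_le)
    also have "\<dots> = pi * \<bar>x - y\<bar> * (\<Prod>i=1..k. \<omega> i)"
      using r(1)[of k] by (simp add: abs_mult flip: left_diff_distrib right_diff_distrib)
    also have "\<dots> \<le> pi * \<bar>x - y\<bar> * b ^ k"
      using r(2)[of k] by (intro mult_left_mono) auto
    finally show "\<bar>\<bar>cos (pi * x * (\<Prod>i=1..k. \<omega> i))\<bar> - \<bar>cos (pi * y * (\<Prod>i=1..k. \<omega> i))\<bar>\<bar>
      \<le> pi * \<bar>x - y\<bar> * b ^ k" .
  qed
  also have "\<dots> = pi * \<bar>x - y\<bar> * (\<Sum>k=1..n. b ^ k)"
    by (simp add: sum_distrib_left)
  also have "\<dots> \<le> pi * \<bar>x - y\<bar> * (\<Sum>k. b ^ k)"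
    using assms(2,3) by (intro mult_left_mono sum_le_suminf summable_geometric) auto
  also have "\<dots> = pi / (1 - b) * \<bar>x - y\<bar>"
    using assms(2,3) by (simp add: suminf_geometric)
  finally show ?thesis .
qed

section \<open>The Fourier transform of a Bernoulli convolution\<close>

lemma cmod_one_plus_iexp: "cmod ((1 + iexp (2 * x)) / 2) = \<bar>cos x\<bar>"
proof -
  have "iexp (2 * x) = iexp x * iexp x"
    by (simp add: algebra_simps flip: exp_add)
  moreover have "1 = iexp x * iexp (- x)"
    by (simp flip: exp_add)
  ultimately have "(1 + iexp (2 * x)) / 2 = iexp x * ((iexp x + iexp (- x)) / 2)"
    by (simp add: algebra_simps)
  also have "(iexp x + iexp (- x)) / 2 = of_real (cos x)"
    by (simp add: complex_eq_iff Re_exp Im_exp)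
  finally show ?thesis
    by (simp add: norm_mult)
qed

text \<open>
  The digits are independent, so the integral is the product of the integrals
  \<open>(1 + exp (- 2 \<pi> i \<xi> r\<^sub>k)) / 2\<close> over a single digit.
\<close>

lemma integral_fair_digits_phase:
  "cmod (\<integral>d. iexp (\<Sum>k=1..n. - 2 * pi * \<xi> * (d k * r k)) \<partial>fair_digits)
    = (\<Prod>k=1..n. \<bar>cos (pi * \<xi> * r k)\<bar>)"
proof -
  let ?D = "uniform_count_measure {0, 1 :: real}"
  let ?f = "\<lambda>k d. iexp (- 2 * pi * \<xi> * (d * r k))"
  interpret D: product_prob_space "\<lambda>_. ?D" "{1::nat..}"
    by (intro product_prob_spaceI prob_space_uniform_count_measure) auto
  have meas[measurable]: "f \<in> borel_measurable ?D" for f :: "real \<Rightarrow> complex"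
    by (auto simp: measurable_def space_uniform_count_measure sets_uniform_count_measure)
  have int: "integrable ?D (?f k)" for k
    unfolding uniform_count_measure_def by (rule integrable_point_measure_finite) simp
  have restr: "(\<lambda>d. restrict d {1..n}) \<in> measurable fair_digits (PiM {1..n} (\<lambda>_. ?D))"
    unfolding fair_digits_def by (rule measurable_restrict_subset) auto
  have "(\<integral>d. iexp (\<Sum>k=1..n. - 2 * pi * \<xi> * (d k * r k)) \<partial>fair_digits)
      = (\<integral>d. (\<Prod>k=1..n. ?f k (restrict d {1..n} k)) \<partial>fair_digits)"
    by (simp add: exp_sum sum_distrib_left)
  also have "\<dots> = (\<integral>d. (\<Prod>k=1..n. ?f k (d k)) \<partial>distr fair_digits (PiM {1..n} (\<lambda>_. ?D)) (\<lambda>d. restrict d {1..n}))"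
    using restr by (subst integral_distr) auto
  also have "distr fair_digits (PiM {1..n} (\<lambda>_. ?D)) (\<lambda>d. restrict d {1..n}) = PiM {1..n} (\<lambda>_. ?D)"
    unfolding fair_digits_def by (rule D.distr_PiM_restrict_finite) auto
  also have "(\<integral>d. (\<Prod>k=1..n. ?f k (d k)) \<partial>PiM {1..n} (\<lambda>_. ?D)) = (\<Prod>k=1..n. integral\<^sup>L ?D (?f k))"
    by (rule D.product_integral_prod) (use int in auto)
  also have "\<dots> = (\<Prod>k=1..n. (1 + iexp (2 * (- pi * \<xi> * r k))) / 2)"
    unfolding uniform_count_measure_def
    by (intro prod.cong refl, subst lebesgue_integral_point_measure_finite)
       (auto simp: scaleR_conv_of_real field_simps)
  finally show ?thesis
    by (simp only: prod_norm[symmetric] cmod_one_plus_iexp) simp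
qed

text \<open>
  By dominated convergence the Fourier transform is the limit of those of the truncated digit sums,
  whose absolute values are the products of cosines; these decrease with the number of factors.
\<close>

lemma cmod_fourier_transform_le_cosine_product:
  assumes \<omega>: "\<And>k. 1 \<le> k \<Longrightarrow> 0 \<le> \<omega> k \<and> \<omega> k \<le> b" and "0 < b" "b < 1"
  shows "cmod (fourier_transform (bernoulli_convolution \<omega>) \<xi>) \<le> cosine_product \<omega> n \<xi>"
proof -
  note r = prod_le_power_of_bound[where \<omega> = \<omega>, OF \<omega>]
  interpret prob_space fair_digits by (rule prob_space_fair_digits)
  let ?r = "\<lambda>k. \<Prod>i=1..k. \<omega> i"
  let ?s = "\<lambda>n d. iexp (\<Sum>k=1..n. - 2 * pi * \<xi> * (d k * ?r k))"
  have digit_meas: "(\<lambda>d. d k) \<in> borel_measurable fair_digits" if "k \<in> {1..n}" for k n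
  proof -
    have "(\<lambda>d. d k) \<in> measurable fair_digits (uniform_count_measure {0, 1 :: real})"
      unfolding fair_digits_def using that by (intro measurable_component_singleton) simp
    moreover have "(\<lambda>x. x) \<in> borel_measurable (uniform_count_measure {0, 1 :: real})"
      by (auto simp: measurable_def space_uniform_count_measure sets_uniform_count_measure)
    ultimately show ?thesis
      by (rule measurable_compose)
  qed
  note measurable_digit_sum[measurable]
  have "(\<lambda>n. \<integral>d. ?s n d \<partial>fair_digits) \<longlonglongrightarrow> (\<integral>d. iexp (- 2 * pi * \<xi> * digit_sum \<omega> d) \<partial>fair_digits)"
  proof (rule integral_dominated_convergence[where w = "\<lambda>_. 1"])
    have lim: "(\<lambda>n. \<Sum>k=1..n. d k * ?r k) \<longlonglongrightarrow> digit_sum \<omega> d" if "d \<in> space fair_digits" for d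
    proof -
      have d: "d k \<in> {0, 1}" if "1 \<le> k" for k
        using \<open>d \<in> space fair_digits\<close> that
        by (auto simp: fair_digits_def space_PiM space_uniform_count_measure PiE_def Pi_def)
      have "summable (\<lambda>j. d (Suc j) * ?r (Suc j))"
      proof (rule summable_comparison_test')
        show "summable (\<lambda>j. b * b ^ j)"
          using assms(2,3) by (intro summable_mult summable_geometric) auto
        show "norm (d (Suc j) * ?r (Suc j)) \<le> b * b ^ j" if "0 \<le> j" for j
          using d[of "Suc j"] r[of "Suc j"] assms(2) by (auto simp: abs_mult)
      qed
      then show ?thesis
        unfolding digit_sum_def One_nat_def sum.atLeast1_atMost_eq by (rule summable_LIMSEQ)
    qed
    show "AE d in fair_digits. (\<lambda>n. ?s n d) \<longlonglongrightarrow> iexp (- 2 * pi * \<xi> * digit_sum \<omega> d)"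
      unfolding sum_distrib_left[symmetric]
      by (intro AE_I2 tendsto_exp tendsto_mult tendsto_of_real tendsto_const lim)
    have [measurable]: "(\<lambda>d. \<Sum>k=1..n. - 2 * pi * \<xi> * (d k * ?r k)) \<in> borel_measurable fair_digits" for n
      by (intro borel_measurable_sum borel_measurable_times borel_measurable_const digit_meas)
    show "?s n \<in> borel_measurable fair_digits" for n
      by measurable
    show "(\<lambda>d. iexp (- 2 * pi * \<xi> * digit_sum \<omega> d)) \<in> borel_measurable fair_digits"
      by measurable
    show "AE d in fair_digits. cmod (?s n d) \<le> 1" for n
      by (intro AE_I2) (simp only: norm_exp_i_times order_refl)
  qed simp
  then have "(\<lambda>n. cmod (\<integral>d. ?s n d \<partial>fair_digits))
      \<longlonglongrightarrow> cmod (fourier_transform (bernoulli_convolution \<omega>) \<xi>)"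
    unfolding fourier_transform_def bernoulli_convolution_def
    by (subst integral_distr) (auto intro!: tendsto_norm)
  moreover have "cmod (\<integral>d. ?s m d \<partial>fair_digits) \<le> cosine_product \<omega> n \<xi>" if "n \<le> m" for m
    unfolding integral_fair_digits_phase
    using cosine_product_antimono[OF that] by (simp add: cosine_product_def)
  ultimately show ?thesis
    by (blast intro: LIMSEQ_le_const2)
qed

section \<open>Means of powers of the cosine\<close>

lemma nn_integral_cos_power_tendsto_0:
  "(\<lambda>p. \<integral>\<^sup>+x\<in>{0..1}. ennreal (\<bar>cos (pi * x)\<bar> ^ p) \<partial>lborel) \<longlonglongrightarrow> 0"
proof -
  have "(\<lambda>p. \<integral>\<^sup>+x. ennreal (\<bar>cos (pi * x)\<bar> ^ p) * indicator {0..1} x \<partial>lborel)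
      \<longlonglongrightarrow> (\<integral>\<^sup>+x. 0 \<partial>(lborel :: real measure))"
  proof (rule nn_integral_dominated_convergence[where w = "indicator {0..1}"])
    show "AE x in lborel. ennreal (\<bar>cos (pi * x)\<bar> ^ p) * indicator {0..1} x \<le> indicator {0..1} x" for p
      by (auto simp: power_le_one split: split_indicator)
    show "AE x in lborel. (\<lambda>p. ennreal (\<bar>cos (pi * x)\<bar> ^ p) * indicator {0..1} x) \<longlonglongrightarrow> 0"
      using AE_lborel_singleton[of 0] AE_lborel_singleton[of 1]
    proof eventually_elim
      case (elim x)
      show ?case
      proof (cases "x \<in> {0..1}")
        case True
        with elim have x: "0 < x" "x < 1" by auto
        have "cos (pi * x) < cos 0"
          using x by (intro cos_monotone_0_pi) auto
        moreover have "cos pi < cos (pi * x)"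
          using x by (intro cos_monotone_0_pi) auto
        ultimately have "\<bar>cos (pi * x)\<bar> < 1" by simp
        then have "(\<lambda>p. ennreal (\<bar>cos (pi * x)\<bar> ^ p)) \<longlonglongrightarrow> ennreal 0"
          by (intro tendsto_ennrealI LIMSEQ_power_zero) auto
        then show ?thesis using True by simp
      qed simp
    qed
  qed auto
  then show ?thesis by simp
qed

lemma nn_integral_cos_power_periods:
  "(\<integral>\<^sup>+x\<in>{of_int k..of_int k + real n}. ennreal (\<bar>cos (pi * x)\<bar> ^ p) \<partial>lborel)
    \<le> of_nat n * (\<integral>\<^sup>+x\<in>{0..1}. ennreal (\<bar>cos (pi * x)\<bar> ^ p) \<partial>lborel)"
proof (induction n)
  case 0
  have "(\<integral>\<^sup>+x\<in>{of_int k}. ennreal (\<bar>cos (pi * x)\<bar> ^ p) \<partial>lborel) = 0"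
    by (subst nn_integral_indicator_singleton) auto
  then show ?case by simp
next
  case (Suc n)
  let ?f = "\<lambda>x. ennreal (\<bar>cos (pi * x)\<bar> ^ p)"
  let ?u = "of_int k + real n"
  have cos_shift: "\<bar>cos (pi * (?u + x))\<bar> = \<bar>cos (pi * x)\<bar>" for x
  proof -
    have "pi * (?u + x) = pi * x + of_int (k + int n) * pi" by (simp add: algebra_simps)
    moreover have s: "sin (of_int (k + int n) * pi) = 0"
      by (subst sin_times_pi_eq_0) simp
    moreover have "\<bar>cos (of_int (k + int n) * pi)\<bar> = 1"
      using sin_cos_squared_add[of "of_int (k + int n) * pi"] unfolding s
      by (simp add: abs_square_eq_1)
    ultimately show ?thesis
      by (simp only: cos_add) (simp add: abs_mult)
  qed
  have "(\<integral>\<^sup>+x\<in>{of_int k..of_int k + real (Suc n)}. ?f x \<partial>lborel)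
      \<le> (\<integral>\<^sup>+x. ?f x * indicator {of_int k..?u} x + ?f x * indicator {?u..?u + 1} x \<partial>lborel)"
    by (intro nn_integral_mono) (auto split: split_indicator)
  also have "\<dots> = (\<integral>\<^sup>+x\<in>{of_int k..?u}. ?f x \<partial>lborel) + (\<integral>\<^sup>+x\<in>{?u..?u + 1}. ?f x \<partial>lborel)"
    by (intro nn_integral_add) auto
  also have "(\<integral>\<^sup>+x\<in>{?u..?u + 1}. ?f x \<partial>lborel)
      = (\<integral>\<^sup>+x. ?f (?u + 1 * x) * indicator {?u..?u + 1} (?u + 1 * x) \<partial>lborel)"
    by (subst nn_integral_real_affine[where c = 1 and t = ?u]) auto
  also have "\<dots> = (\<integral>\<^sup>+x\<in>{0..1}. ?f x \<partial>lborel)"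
    by (intro nn_integral_cong) (auto simp: cos_shift split: split_indicator)
  finally show ?case
    using Suc.IH by (auto simp: algebra_simps intro: order_trans add_mono)
qed

text \<open>
  Rescaling by \<open>t\<close> turns the integral into one over an interval of length \<open>t (b - a) \<ge> 1\<close>. Rounding
  its end points to integers covers it by at most \<open>t (b - a) + 2 \<le> 3 t (b - a)\<close> unit intervals, so the
  mean over \<open>{a..b}\<close> is at most three times the mean over a period. The threshold \<open>1 / (b - a)\<close>
  does not involve \<open>p\<close>.
\<close>

lemma cos_power_mean_small:
  fixes a b q :: real
  assumes "a < b" "0 < q"
  obtains p where "2 \<le> p"
    and "\<And>t. 1 / (b - a) \<le> t \<Longrightarrow>
      (\<integral>\<^sup>+y. ennreal (\<bar>cos (pi * (t * y))\<bar> ^ p) \<partial>uniform_measure lborel {a..b}) \<le> ennreal q"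
proof -
  let ?c = "\<lambda>p. \<integral>\<^sup>+x\<in>{0..1}. ennreal (\<bar>cos (pi * x)\<bar> ^ p) \<partial>lborel"
  have "eventually (\<lambda>p. ?c p < ennreal (q / 3)) sequentially"
    using assms(2) by (intro order_tendstoD[OF nn_integral_cos_power_tendsto_0]) auto
  then have "eventually (\<lambda>p. ?c p < ennreal (q / 3) \<and> 2 \<le> p) sequentially"
    by (intro eventually_conj eventually_ge_at_top)
  then obtain p where p: "?c p < ennreal (q / 3)" "2 \<le> p"
    by (auto simp: eventually_sequentially)
  show thesis
  proof (rule that[OF p(2)])
    fix t assume t: "1 / (b - a) \<le> t"
    have t0: "0 < t" using t assms(1) by (meson diff_gt_0_iff_gt divide_pos_pos less_le_trans zero_less_one)
    have t1: "1 \<le> t * (b - a)" using t assms(1) by (simp add: field_simps)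
    let ?f = "\<lambda>x. ennreal (\<bar>cos (pi * x)\<bar> ^ p)"
    let ?J = "\<integral>\<^sup>+y\<in>{a..b}. ?f (t * y) \<partial>lborel"
    define k where "k = \<lfloor>t * a\<rfloor>"
    define n where "n = nat (\<lceil>t * b\<rceil> - k)"
    have "t * a \<le> t * b" using t0 assms(1) by simp
    then have "k \<le> \<lceil>t * b\<rceil>" unfolding k_def by linarith
    then have n: "real n = of_int \<lceil>t * b\<rceil> - of_int k" unfolding n_def by simp
    have n_le: "real n \<le> 3 * (t * (b - a))"
      using t1 unfolding n k_def by (simp add: algebra_simps) linarith
    have "ennreal t * ?J = (\<integral>\<^sup>+x\<in>{t * a..t * b}. ?f x \<partial>lborel)"
      using t0 by (subst (2) nn_integral_real_affine[where c = t and t = 0])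
        (auto intro!: arg_cong2[where f = "(*)"] nn_integral_cong split: split_indicator)
    also have "\<dots> \<le> (\<integral>\<^sup>+x\<in>{of_int k..of_int k + real n}. ?f x \<partial>lborel)"
      unfolding n k_def by (intro nn_integral_mono) (auto split: split_indicator, linarith+)
    also have "\<dots> \<le> of_nat n * ?c p"
      by (rule nn_integral_cos_power_periods)
    also have "\<dots> \<le> ennreal (real n) * ennreal (q / 3)"
      using p(1) by (intro mult_mono) (auto simp: ennreal_of_nat_eq_real_of_nat)
    also have "\<dots> = ennreal (real n * (q / 3))"
      using assms(2) by (subst ennreal_mult) auto
    also have "\<dots> \<le> ennreal (3 * (t * (b - a)) * (q / 3))"
      using n_le assms(2) by (intro ennreal_leI mult_right_mono) auto
    also have "\<dots> = ennreal t * (ennreal q * ennreal (b - a))"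
      using t0 assms by (simp add: mult_ac flip: ennreal_mult)
    finally have "?J \<le> ennreal q * ennreal (b - a)"
      using t0 by (simp add: ennreal_mult_le_mult_iff)
    moreover have "(\<integral>\<^sup>+y. ?f (t * y) \<partial>uniform_measure lborel {a..b}) = ?J / ennreal (b - a)"
      using assms(1) by (subst nn_integral_uniform_measure) auto
    ultimately show "(\<integral>\<^sup>+y. ?f (t * y) \<partial>uniform_measure lborel {a..b}) \<le> ennreal q"
      using assms(1) by (auto intro!: divide_le_posI_ennreal simp: mult.commute)
  qed
qed

section \<open>Moments of products over a random multiplicative walk\<close>

text \<open>
  Given the first \<open>k - 1\<close> coordinates, the \<open>k\<close>-th factor is \<open>g (t * \<omega> k)\<close> with
  \<open>t \<ge> \<xi> * a ^ (k - 1) \<ge> R\<close>, so integrating out the last coordinate costs a factor \<open>q\<close>.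
\<close>

lemma nn_integral_PiM_prod_partial_products_le:
  fixes M :: "real measure" and g :: "real \<Rightarrow> ennreal"
  assumes "prob_space M" and sets_M[measurable_cong]: "sets M = sets borel"
    and supp: "AE y in M. a \<le> y" and "0 \<le> a" "0 \<le> \<xi>"
    and g[measurable]: "g \<in> borel_measurable borel"
    and small: "\<And>t. R \<le> t \<Longrightarrow> (\<integral>\<^sup>+y. g (t * y) \<partial>M) \<le> q"
    and large: "\<And>k. k < n \<Longrightarrow> R \<le> \<xi> * a ^ k"
  shows "(\<integral>\<^sup>+\<omega>. (\<Prod>k=1..n. g (\<xi> * (\<Prod>i=1..k. \<omega> i))) \<partial>PiM {1..} (\<lambda>_. M)) \<le> q ^ n"
proof -
  interpret product_prob_space "\<lambda>_. M" "{1::nat..}"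
    by (intro product_prob_spaceI assms)
  let ?F = "\<lambda>n (\<omega> :: nat \<Rightarrow> real). \<Prod>k=1..n. g (\<xi> * (\<Prod>i=1..k. \<omega> i))"
  have F_meas: "?F n \<in> borel_measurable (PiM {1..n} (\<lambda>_. M))" for n
    by measurable
  have fin: "(\<integral>\<^sup>+\<omega>. ?F n \<omega> \<partial>PiM {1..n} (\<lambda>_. M)) \<le> q ^ n"
    using large
  proof (induction n)
    case 0
    interpret P0: prob_space "PiM {} (\<lambda>_::nat. M)"
      by (intro prob_space_PiM assms)
    show ?case by (simp add: P0.emeasure_space_1)
  next
    case (Suc n)
    let ?P = "PiM {1..n} (\<lambda>_. M)"
    have ivl: "PiM {1..Suc n} (\<lambda>_. M) = PiM (insert (Suc n) {1..n}) (\<lambda>_. M)"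
      by (intro arg_cong2[where f = PiM]) auto
    have last: "?F (Suc n) (fun_upd \<omega> (Suc n) y) = ?F n \<omega> * g (\<xi> * (\<Prod>i=1..n. \<omega> i) * y)" for \<omega> y
    proof -
      have "(\<Prod>i=1..k. (fun_upd \<omega> (Suc n) y) i) = (\<Prod>i=1..k. \<omega> i)" if "k \<le> n" for k
        using that by (intro prod.cong) auto
      then show ?thesis
        by (simp add: prod.nat_ivl_Suc' mult_ac)
    qed
    have "(\<integral>\<^sup>+\<omega>. ?F (Suc n) \<omega> \<partial>PiM {1..Suc n} (\<lambda>_. M))
        = (\<integral>\<^sup>+\<omega>. (\<integral>\<^sup>+y. ?F (Suc n) (fun_upd \<omega> (Suc n) y) \<partial>M) \<partial>?P)"
      using F_meas[of "Suc n"] unfolding ivl by (rule product_nn_integral_insert[rotated 2]) auto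
    also have "\<dots> = (\<integral>\<^sup>+\<omega>. ?F n \<omega> * (\<integral>\<^sup>+y. g (\<xi> * (\<Prod>i=1..n. \<omega> i) * y) \<partial>M) \<partial>?P)"
      unfolding last by (intro nn_integral_cong nn_integral_cmult) measurable
    also have "\<dots> \<le> (\<integral>\<^sup>+\<omega>. ?F n \<omega> * q \<partial>?P)"
    proof (rule nn_integral_mono_AE)
      have "AE \<omega> in ?P. \<forall>i\<in>{1..n}. a \<le> \<omega> i"
        by (intro AE_finite_allI AE_PiM_component assms supp) auto
      then show "AE \<omega> in ?P. ?F n \<omega> * (\<integral>\<^sup>+y. g (\<xi> * (\<Prod>i=1..n. \<omega> i) * y) \<partial>M) \<le> ?F n \<omega> * q"
      proof eventually_elim
        case (elim \<omega>)
        have "(\<Prod>i=1..n. a) \<le> (\<Prod>i=1..n. \<omega> i)"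
          using elim \<open>0 \<le> a\<close> by (intro prod_mono) auto
        then have "\<xi> * a ^ n \<le> \<xi> * (\<Prod>i=1..n. \<omega> i)"
          using \<open>0 \<le> \<xi>\<close> by (intro mult_left_mono) auto
        then show ?case
          using Suc.prems[of n] by (intro mult_left_mono small) auto
      qed
    qed
    also have "\<dots> = (\<integral>\<^sup>+\<omega>. ?F n \<omega> \<partial>?P) * q"
      by (intro nn_integral_multc) measurable
    also have "\<dots> \<le> q ^ n * q"
      using Suc by (intro mult_right_mono) auto
    finally show ?case by (simp add: mult.commute)
  qed
  have restr: "(\<lambda>\<omega>. restrict \<omega> {1..n}) \<in> measurable (PiM {1..} (\<lambda>_. M)) (PiM {1..n} (\<lambda>_. M))"
    by (rule measurable_restrict_subset) auto
  have "(\<integral>\<^sup>+\<omega>. ?F n \<omega> \<partial>PiM {1..} (\<lambda>_. M)) = (\<integral>\<^sup>+\<omega>. ?F n (restrict \<omega> {1..n}) \<partial>PiM {1..} (\<lambda>_. M))"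
    by (intro nn_integral_cong prod.cong refl) (auto intro!: arg_cong[where f = g] prod.cong)
  also have "\<dots> = (\<integral>\<^sup>+\<omega>. ?F n \<omega> \<partial>distr (PiM {1..} (\<lambda>_. M)) (PiM {1..n} (\<lambda>_. M)) (\<lambda>\<omega>. restrict \<omega> {1..n}))"
    using restr F_meas by (subst nn_integral_distr) auto
  also have "distr (PiM {1..} (\<lambda>_. M)) (PiM {1..n} (\<lambda>_. M)) (\<lambda>\<omega>. restrict \<omega> {1..n}) = PiM {1..n} (\<lambda>_. M)"
    by (rule distr_PiM_restrict_finite) auto
  also note fin
  finally show ?thesis .
qed


section \<open>From moments to almost sure decay\<close>

text \<open>The sum of all the variables has finite expectation, so it is finite almost surely, and it
  dominates each of its terms.\<close>

lemma (in prob_space) AE_bounded_of_summable_expectations: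
  fixes X :: "nat \<Rightarrow> 'a \<Rightarrow> real"
  assumes X[measurable]: "\<And>m. X m \<in> borel_measurable M" and "\<And>m. 0 \<le> c m" "summable c"
    and E: "\<And>m. (\<integral>\<^sup>+\<omega>. ennreal (X m \<omega>) \<partial>M) \<le> ennreal (c m)"
  shows "AE \<omega> in M. \<exists>C. \<forall>m. X m \<omega> \<le> C"
proof -
  have "(\<integral>\<^sup>+\<omega>. (\<Sum>m. ennreal (X m \<omega>)) \<partial>M) = (\<Sum>m. \<integral>\<^sup>+\<omega>. ennreal (X m \<omega>) \<partial>M)"
    by (intro nn_integral_suminf) measurable
  also have "\<dots> \<le> (\<Sum>m. ennreal (c m))"
    by (intro suminf_le E) auto
  also have "\<dots> < \<infinity>"
    using assms(2,3) by (simp add: suminf_ennreal2)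
  finally have "AE \<omega> in M. (\<Sum>m. ennreal (X m \<omega>)) \<noteq> \<infinity>"
    by (intro nn_integral_PInf_AE) (auto simp: less_top)
  then show ?thesis
  proof eventually_elim
    case (elim \<omega>)
    then obtain C where C: "(\<Sum>m. ennreal (X m \<omega>)) = ennreal C" "0 \<le> C"
      by (cases "(\<Sum>m. ennreal (X m \<omega>))") auto
    have "ennreal (X m \<omega>) \<le> ennreal C" for m
      using sum_le_suminf[of "\<lambda>m. ennreal (X m \<omega>)" "{m}"] C(1) by simp
    then show ?case
      using C(2) by (auto simp: ennreal_le_iff)
  qed
qed

text \<open>
  A frequency \<open>x \<ge> 1\<close> is compared with \<open>\<surd>m\<close> for \<open>m = \<lfloor>x\<^sup>2\<rfloor>\<close>. The distance is at most \<open>1 / x\<close>, so the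
  Lipschitz bound costs \<open>L / x\<close>, which is \<open>O(x\<^sup>-\<^sup>2\<^sup>/\<^sup>p)\<close> because \<open>p \<ge> 2\<close>. Only the majorant \<open>P m\<close>
  belonging to the grid point itself is controlled, so \<open>P\<close> may change with \<open>m\<close> as long as its
  Lipschitz constant does not.
\<close>

lemma decay_of_sqrt_grid_bound:
  fixes f :: "real \<Rightarrow> real" and P :: "nat \<Rightarrow> real \<Rightarrow> real"
  assumes p: "2 \<le> p"
    and f1: "\<And>\<xi>. f \<xi> \<le> 1" and fP: "\<And>n \<xi>. f \<xi> \<le> P n \<bar>\<xi>\<bar>"
    and P0: "\<And>n \<xi>. 0 \<le> P n \<xi>"
    and lip: "\<And>n x y. \<bar>P n x - P n y\<bar> \<le> L * \<bar>x - y\<bar>" and L: "0 \<le> L"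
    and grid: "\<And>m. 1 \<le> m \<Longrightarrow> real m * P m (sqrt (real m)) ^ p \<le> C"
  shows "\<exists>D>0. \<forall>\<xi>. \<xi> \<noteq> 0 \<longrightarrow> f \<xi> \<le> D * \<bar>\<xi>\<bar> powr (- (2 / real p))"
proof -
  define D where "D = (2 * C) powr (1 / real p) + L + 1"
  have C0: "0 \<le> C"
    using grid[of 1] P0[of 1 1] by (auto intro: order_trans[rotated])
  have D1: "1 \<le> D" unfolding D_def using L by simp
  have "f \<xi> \<le> D * \<bar>\<xi>\<bar> powr (- (2 / real p))" if "\<xi> \<noteq> 0" for \<xi>
  proof (cases "\<bar>\<xi>\<bar> < 1")
    case True
    have "\<bar>\<xi>\<bar> powr (2 / real p) \<le> 1"
      using True by (intro powr_le1) auto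
    then have "1 \<le> \<bar>\<xi>\<bar> powr (- (2 / real p))"
      using that by (simp add: powr_minus one_le_inverse_iff)
    then have "1 * 1 \<le> D * \<bar>\<xi>\<bar> powr (- (2 / real p))"
      using D1 by (intro mult_mono) auto
    then show ?thesis using f1[of \<xi>] by simp
  next
    case False
    define x where "x = \<bar>\<xi>\<bar>"
    have x1: "1 \<le> x" using False by (simp add: x_def)
    define m where "m = nat \<lfloor>x\<^sup>2\<rfloor>"
    have "1 \<le> x\<^sup>2" using x1 by (simp add: one_le_power)
    then have m1: "1 \<le> m" and m: "real m \<le> x\<^sup>2" "x\<^sup>2 < real m + 1"
      unfolding m_def by linarith+
    let ?y = "sqrt (real m)"
    have y: "0 \<le> ?y" "?y \<le> x"
      using m(1) x1 by (auto intro: real_le_lsqrt)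
    have "(x - ?y) * x \<le> (x - ?y) * (x + ?y)"
      using y by (intro mult_left_mono) auto
    also have "\<dots> = x\<^sup>2 - real m"
      by (simp add: algebra_simps power2_eq_square)
    also have "\<dots> \<le> 1" using m(2) by simp
    finally have "x - ?y \<le> x powr (- 1)"
      using x1 by (simp add: powr_minus field_simps)
    also have "\<dots> \<le> x powr (- (2 / real p))"
      using x1 p by (intro powr_mono) auto
    finally have step: "L * \<bar>x - ?y\<bar> \<le> L * x powr (- (2 / real p))"
      using y L by (intro mult_left_mono) auto
    have "P m ?y ^ p \<le> C / real m"
      using grid[OF m1] m1 by (simp add: field_simps)
    also have "\<dots> \<le> C / (x\<^sup>2 / 2)"
      using C0 m m1 x1 by (intro divide_left_mono) auto
    also have "\<dots> = ((2 * C) powr (1 / real p)) ^ p * (x powr (- (2 / real p))) ^ p"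
    proof -
      have "((2 * C) powr (1 / real p)) ^ p = 2 * C"
        using C0 p by (cases "C = 0") (auto simp: powr_power power_0_left)
      moreover have "(x powr (- (2 / real p))) ^ p = x powr (- 2)"
        using x1 p by (subst powr_power) auto
      moreover have "x powr (- 2) = 1 / x\<^sup>2"
        using x1 by (simp add: powr_minus_divide)
      ultimately show ?thesis by simp
    qed
    also have "\<dots> = ((2 * C) powr (1 / real p) * x powr (- (2 / real p))) ^ p"
      by (rule power_mult_distrib[symmetric])
    finally have "P m ?y \<le> (2 * C) powr (1 / real p) * x powr (- (2 / real p))"
      using P0 p by (subst (asm) power_mono_iff) auto
    moreover have "f \<xi> \<le> P m ?y + L * \<bar>x - ?y\<bar>"
      using fP[of \<xi> m] lip[of m x ?y] by (simp add: x_def)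
    ultimately have "f \<xi> \<le> ((2 * C) powr (1 / real p) + L) * x powr (- (2 / real p))"
      using step by (simp add: algebra_simps)
    also have "\<dots> \<le> D * x powr (- (2 / real p))"
      unfolding D_def by (intro mult_right_mono) auto
    finally show ?thesis by (simp add: x_def)
  qed
  then show ?thesis using D1 by (intro exI[of _ D]) auto
qed

section \<open>Almost sure polynomial decay\<close>

theorem theorem3:
  fixes lmin lmax :: real
  assumes "0 < lmin" and "lmin < lmax" and "lmax < 1"
  shows "\<exists>\<rho>>0. AE \<omega> in iid_uniform lmin lmax. \<exists>C>0. \<forall>\<xi>::real. \<xi> \<noteq> 0 \<longrightarrow>
           cmod (fourier_transform (bernoulli_convolution \<omega>) \<xi>) \<le> C * \<bar>\<xi>\<bar> powr (- \<rho>)"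
proof -
  let ?U = "uniform_measure lborel {lmin..lmax}"
  define R where "R = 1 / (lmax - lmin)"
  have R: "0 < R" using assms by (simp add: R_def)
  \<comment> \<open>The exponent 6 gives moments of order \<open>\<xi> powr - 6\<close>, that is, \<open>m powr - 3\<close> at \<open>\<xi> = sqrt m\<close>; these
    stay summable after multiplication by \<open>m\<close>.\<close>
  obtain p where p: "2 \<le> p"
    and small: "\<And>t. R \<le> t \<Longrightarrow> (\<integral>\<^sup>+y. ennreal (\<bar>cos (pi * (t * y))\<bar> ^ p) \<partial>?U) \<le> ennreal (lmin ^ 6)"
    unfolding R_def using cos_power_mean_small[of lmin lmax "lmin ^ 6"] assms by auto
  have U: "prob_space ?U"
    using assms by (intro prob_space_uniform_measure) auto
  interpret \<Omega>: prob_space "iid_uniform lmin lmax"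
    by (rule prob_space_iid_uniform) (rule assms)
  have supp: "AE y in ?U. lmin \<le> y \<and> y \<le> lmax"
    by (rule AE_uniform_measureI) auto
  \<comment> \<open>All factors whose argument is certain to be large are kept: the moment bound holds for
    \<open>n m\<close> factors, while \<open>lmin ^ n m < R / sqrt m\<close>.\<close>
  define n where "n m = (LEAST n. sqrt (real m) * lmin ^ n < R)" for m
  have moment: "(\<integral>\<^sup>+\<omega>. ennreal (real m * cosine_product \<omega> (n m) (sqrt (real m)) ^ p) \<partial>iid_uniform lmin lmax)
      \<le> ennreal (R ^ 6 / real m ^ 2)" if m: "1 \<le> m" for m
  proof -
    let ?y = "sqrt (real m)"
    have "(\<lambda>n. ?y * lmin ^ n) \<longlonglongrightarrow> ?y * 0"
      using assms by (intro tendsto_mult tendsto_const LIMSEQ_power_zero) auto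
    then have "eventually (\<lambda>n. ?y * lmin ^ n < R) sequentially"
      using R by (intro order_tendstoD) auto
    then have "\<exists>n. ?y * lmin ^ n < R"
      by (auto simp: eventually_sequentially)
    then have n: "?y * lmin ^ n m < R"
      unfolding n_def by (rule LeastI_ex)
    have n': "R \<le> ?y * lmin ^ k" if "k < n m" for k
      using not_less_Least[OF that[unfolded n_def]] by simp
    have "(\<integral>\<^sup>+\<omega>. ennreal (cosine_product \<omega> (n m) ?y ^ p) \<partial>iid_uniform lmin lmax)
        = (\<integral>\<^sup>+\<omega>. (\<Prod>k=1..n m. ennreal (\<bar>cos (pi * (?y * (\<Prod>i=1..k. \<omega> i)))\<bar> ^ p)) \<partial>PiM {1..} (\<lambda>_. ?U))"
      unfolding cosine_product_def iid_uniform_def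
      by (simp add: prod_power_distrib prod_ennreal mult.assoc)
    also have "\<dots> \<le> ennreal (lmin ^ 6) ^ n m"
      using assms
      by (intro nn_integral_PiM_prod_partial_products_le[where a = lmin and R = R
            and g = "\<lambda>t. ennreal (\<bar>cos (pi * t)\<bar> ^ p)"] U small n')
        (use supp in \<open>auto elim: eventually_mono\<close>)
    also have "\<dots> = ennreal ((lmin ^ n m) ^ 6)"
      using assms by (simp add: ennreal_power power_commutes flip: power_mult) (simp add: mult.commute)
    also have "\<dots> \<le> ennreal ((R / ?y) ^ 6)"
      using n m assms R by (intro ennreal_leI power_mono) (auto simp: field_simps)
    also have "(R / ?y) ^ 6 = R ^ 6 / real m ^ 3"
    proof -
      have "?y ^ 6 = (?y ^ 2) ^ 3" by (subst power_mult[symmetric]) simp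
      then show ?thesis by (simp add: power_divide)
    qed
    finally have "ennreal (real m) * (\<integral>\<^sup>+\<omega>. ennreal (cosine_product \<omega> (n m) ?y ^ p) \<partial>iid_uniform lmin lmax)
        \<le> ennreal (real m) * ennreal (R ^ 6 / real m ^ 3)"
      by (intro mult_left_mono) auto
    moreover have "ennreal (real m) * (\<integral>\<^sup>+\<omega>. ennreal (cosine_product \<omega> (n m) ?y ^ p) \<partial>iid_uniform lmin lmax)
        = (\<integral>\<^sup>+\<omega>. ennreal (real m * cosine_product \<omega> (n m) ?y ^ p) \<partial>iid_uniform lmin lmax)"
      by (subst nn_integral_cmult[symmetric]) (auto simp: ennreal_mult cosine_product_nonneg)
    moreover have "real m * (R ^ 6 / real m ^ 3) = R ^ 6 / real m ^ 2"
      using m by (simp add: power2_eq_square power3_eq_cube)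
    ultimately show ?thesis
      using R by (simp flip: ennreal_mult)
  qed
  have "AE \<omega> in iid_uniform lmin lmax. \<exists>C. \<forall>m. real (Suc m) * cosine_product \<omega> (n (Suc m)) (sqrt (real (Suc m))) ^ p \<le> C"
  proof (rule \<Omega>.AE_bounded_of_summable_expectations[where c = "\<lambda>m. R ^ 6 / real (Suc m) ^ 2"])
    have "summable (\<lambda>m. R ^ 6 * inverse (real (Suc m) ^ 2))"
      by (intro summable_mult) (subst summable_Suc_iff, rule inverse_power_summable, simp)
    then show "summable (\<lambda>m. R ^ 6 / real (Suc m) ^ 2)"
      by (simp add: divide_inverse)
  qed (use R in \<open>auto intro!: moment simp del: of_nat_Suc\<close>)
  moreover have "AE \<omega> in iid_uniform lmin lmax. \<forall>k\<in>{1..}. lmin \<le> \<omega> k \<and> \<omega> k \<le> lmax"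
    unfolding iid_uniform_def
    by (subst AE_ball_countable)
       (simp, intro ballI AE_PiM_component[where P = "\<lambda>y. lmin \<le> y \<and> y \<le> lmax"] U supp)
  ultimately have "AE \<omega> in iid_uniform lmin lmax. \<exists>C>0. \<forall>\<xi>::real. \<xi> \<noteq> 0 \<longrightarrow>
      cmod (fourier_transform (bernoulli_convolution \<omega>) \<xi>) \<le> C * \<bar>\<xi>\<bar> powr (- (2 / real p))"
  proof eventually_elim
    case (elim \<omega>)
    then obtain C where C: "\<And>m. real (Suc m) * cosine_product \<omega> (n (Suc m)) (sqrt (real (Suc m))) ^ p \<le> C"
      by blast
    have \<omega>: "0 \<le> \<omega> k \<and> \<omega> k \<le> lmax" if "1 \<le> k" for k
      using bspec[OF elim(2), of k] that assms(1) by simp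
    have b: "0 < lmax" "lmax < 1" using assms by auto
    note bound = cmod_fourier_transform_le_cosine_product[where \<omega> = \<omega>, OF \<omega> b]
    show ?case
    proof (rule decay_of_sqrt_grid_bound[where L = "pi / (1 - lmax)" and C = C
          and P = "\<lambda>m. cosine_product \<omega> (n m)", OF p])
      show "cmod (fourier_transform (bernoulli_convolution \<omega>) \<xi>) \<le> 1" for \<xi>
        using bound[where n = 0 and \<xi> = \<xi>] by (simp add: cosine_product_def)
      show "cmod (fourier_transform (bernoulli_convolution \<omega>) \<xi>) \<le> cosine_product \<omega> (n m) \<bar>\<xi>\<bar>" for m \<xi>
        using bound[where n = "n m" and \<xi> = \<xi>] by (cases "0 \<le> \<xi>") (auto simp: cosine_product_minus)
      show "\<bar>cosine_product \<omega> (n m) x - cosine_product \<omega> (n m) y\<bar> \<le> pi / (1 - lmax) * \<bar>x - y\<bar>" for m x y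
        using \<omega> b by (rule cosine_product_lipschitz)
      show "real m * cosine_product \<omega> (n m) (sqrt (real m)) ^ p \<le> C" if "1 \<le> m" for m
        using C[of "m - 1"] that by simp
    qed (use b in \<open>auto simp: cosine_product_nonneg\<close>)
  qed
  moreover have "0 < 2 / real p" using p by simp
  ultimately show ?thesis by blast
qed

end
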